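(* Let $S$ be a closed, connected, oriented surface of genus $g\ge2$, and let $\mathcal{P}(S)$ be the moduli space of marked complex projective structures on $S$ endowed with its canonical complex structure, so that $\mathcal{P}(S)$ is biholomorphic to $\mathcal{T}(S)\times\mathbb{C}^{3g-3}$ and can be viewed as an unbounded domain in $\mathbb{C}^{6g-6}$. Then $\mathcal{P}(S)$ does not carry a Bergman metric.
   Context: **Bergman metric.** For a domain $\Omega\subset\mathbb{C}^n$ let $L^{2,h}(\Omega)$ be the Hilbert space of square integrable holomorphic functions on $\Omega$. For $z\in\Omega$ the evaluation $f\mapsto f(z)$ is a continuous linear functional, so $f(z)=\langle f,\eta_z\rangle$ for a unique $\eta_z\in L^{2,h}(\Omega)$. The Bergman kernel is $k(z,\xi)=\overline{\eta_z(\xi)}$. The Bergman pseudometric is defined provided that $k(z,z)>0$ for every $z\in\Omega$ (equivalently, for every $z$ there is $f\in L^{2,h}(\Omega)$ with $f(z)\ne0$), and is then $b_\Omega=2\sum_{i,j}a_{ij}\,dz^i d\bar z^j$ with $a_{ij}=\frac{\partial^2}{\partial z^i\partial\bar z^j}\log k(z,z)$. $\Omega$ carries a Bergman metric if the pseudometric is defined and is positive definite. For $\mathcal{P}(S)$, these notions refer to its realization as the domain $\mathcal{T}(S)\times\mathbb{C}^{3g-3}\subset\mathbb{C}^{6g-6}$, with $\mathcal{T}(S)\subset\mathbb{C}^{3g-3}$ via the Bers embedding. **Teichmüller space.** $\mathcal{T}(S)$ is the set of pairs $(X,f)$, with $X$ a Riemann surface and $f:S\to X$ an orientation-preserving diffeomorphism,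 modulo $(X,f)\sim(Y,k)$ if there is a biholomorphism $h:X\to Y$ with $k^{-1}\circ h\circ f$ isotopic to the identity of $S$. Its complex structure is given by the Bers embedding. Fix a base Riemann surface $X_0=\mathbb{H}/\Gamma$ marked by $S$, where $\mathbb{H}$ is the upper half-plane and $\Gamma\subset \mathrm{PSL}_2(\mathbb{R})$ is Fuchsian, and let $\mathbb{L}$ be the lower half-plane. Each point of $\mathcal{T}(S)$ is represented by some $\mu\in L^\infty(\mathbb{H})$ with $\|\mu\|_\infty<1$ and $\mu=(\mu\circ\gamma)\overline{\gamma'}/\gamma'$ a.e. for all $\gamma\in\Gamma$. Extend $\mu$ by $0$ to $\mathbb{C}\setminus\mathbb{H}$ and let $w_\mu:\mathbb{CP}^1\to\mathbb{CP}^1$ be the quasiconformal map with Beltrami coefficient $\mu$ fixing $0,1,\infty$. With $\Gamma_\mu=w_\mu\Gamma w_\mu^{-1}$ (a quasi-Fuchsian group), the point of $\mathcal{T}(S)$ represented by $\mu$ is $w_\mu(\mathbb{H})/\Gamma_\mu$ with the marking induced by $w_\mu$. The Bers embedding sends this point to the Schwarzian derivative of $w_\mu|_{\mathbb{L}}$, in the space $Q(\mathbb{L},\Gamma)\cong\mathbb{C}^{3g-3}$ of $\Gamma$-invariant holomorphic quadratic differentials on $\mathbb{L}$. It is injective, its image is a bounded domain, and the induced complex structure on $\mathcal{T}(S)$ does not depend on $X_0$. The cotangent space of $\mathcal{T}(S)$ at $X$ is the space $Q(X)$ of holomorphic quadratic differentials on $X$. **Projective structures.** A (complex) projective structure on $S$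 is a maximal atlas with charts in $\mathbb{CP}^1$ and transition functions that are restrictions of Möbius transformations. $\mathcal{P}(S)$ is the set of pairs $(\sigma,f)$, with $\sigma$ a projective structure and $f:S\to\sigma$ an orientation-preserving diffeomorphism, modulo $(\sigma_1,f)\sim(\sigma_2,k)$ if there is a projective isomorphism $h:\sigma_1\to\sigma_2$ with $k^{-1}\circ h\circ f$ isotopic to the identity of $S$. The forgetful map $\pi:\mathcal{P}(S)\to\mathcal{T}(S)$ sends a projective structure to its underlying complex structure. For $\sigma_0,\sigma$ in the same fibre $\pi^{-1}(X)$, let $\sigma-\sigma_0\in Q(X)$ be the Schwarzian derivative of $\mathrm{id}_S:\sigma_0\to\sigma$ computed in projective charts, where the Schwarzian of $f$ is $\big[(f''/f')'-\tfrac12(f''/f')^2\big]dz^2$. This makes $\pi^{-1}(X)$ an affine space modeled on $Q(X)$. **Canonical complex structure.** For fixed $Y\in\mathcal{T}(S)$, the Bers section $s_Y:\mathcal{T}(S)\to\mathcal{P}(S)$ is defined as follows. For $X\in\mathcal{T}(S)$, Bers' simultaneous uniformization gives a quasi-Fuchsian group $Q(X,Y)\subset\mathrm{PSL}_2(\mathbb{C})$ whose two invariant domains have quotients $X$ and the mirror image $Y^*$ of $Y$; $s_Y(X)$ is $X$ with the projective structure inherited from $\mathbb{CP}^1$ as the quotient of the corresponding invariant domain by $Q(X,Y)$. The canonical complex structure on $\mathcal{P}(S)$ (of complex dimension $6g-6$) is the one making the bijection $\mathcal{P}(S)\to T^*\mathcal{T}(S)$, $\sigma\mapsto(\pi(\sigma),\sigma-s_Y(\pi(\sigma)))$,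 a biholomorphism onto the holomorphic cotangent bundle. It does not depend on $Y$. *)

theory Defs
  imports "HOL-Complex_Analysis.Complex_Analysis" "HOL-Homology.Homology"
begin

unbundle no fps_syntax

section \<open>The Bergman metric of a domain in complex Euclidean space\<close>

text \<open>Partial derivative of \<open>f\<close> at \<open>x\<close> in the real direction \<open>e\<close>.\<close>

definition partial_deriv ::
    "('a::real_normed_vector \<Rightarrow> complex) \<Rightarrow> 'a \<Rightarrow> 'a \<Rightarrow> complex" where
  "partial_deriv f e x = vector_derivative (\<lambda>t::real. f (x + t *\<^sub>R e)) (at 0)"

text \<open>The Wirtinger operators \<open>\<partial>/\<partial>z\<^sup>i\<close> and \<open>\<partial>/\<partial>\<zeta>\<^sup>i\<close>, where \<open>\<zeta>\<^sup>i\<close> is the conjugate of \<open>z\<^sup>i\<close>.\<close>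

definition d_z :: "'n::finite \<Rightarrow> (complex^'n \<Rightarrow> complex) \<Rightarrow> complex^'n \<Rightarrow> complex" where
  "d_z i f z = (partial_deriv f (axis i 1) z - \<i> * partial_deriv f (axis i \<i>) z) / 2"

definition d_zbar :: "'n::finite \<Rightarrow> (complex^'n \<Rightarrow> complex) \<Rightarrow> complex^'n \<Rightarrow> complex" where
  "d_zbar i f z = (partial_deriv f (axis i 1) z + \<i> * partial_deriv f (axis i \<i>) z) / 2"

definition sev_holomorphic_on ::
    "(complex^'n::finite \<Rightarrow> complex) \<Rightarrow> (complex^'n) set \<Rightarrow> bool" where
  "sev_holomorphic_on f \<Omega> \<longleftrightarrow>
     (\<forall>z\<in>\<Omega>. \<exists>f'. (f has_derivative f') (at z within \<Omega>) \<and> (\<forall>c v. f' (c *s v) = c * f' v))"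

text \<open>Functions are total, so an element of the Hilbert space of square integrable holomorphic
  functions is represented by its extension by zero.\<close>

definition L2h :: "(complex^'n::finite) set \<Rightarrow> (complex^'n \<Rightarrow> complex) set" where
  "L2h \<Omega> = {f. sev_holomorphic_on f \<Omega> \<and> (\<forall>z. z \<notin> \<Omega> \<longrightarrow> f z = 0) \<and>
               set_integrable lborel \<Omega> (\<lambda>z. (cmod (f z))\<^sup>2)}"

definition L2_inner ::
    "(complex^'n::finite) set \<Rightarrow> (complex^'n \<Rightarrow> complex) \<Rightarrow> (complex^'n \<Rightarrow> complex) \<Rightarrow> complex" where
  "L2_inner \<Omega> f h = (LINT \<xi>:\<Omega>|lborel. f \<xi> * cnj (h \<xi>))"

definition represents_evaluation ::
    "(complex^'n::finite) set \<Rightarrow> complex^'n \<Rightarrow> (complex^'n \<Rightarrow> complex) \<Rightarrow> bool" where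
  "represents_evaluation \<Omega> z \<eta> \<longleftrightarrow> \<eta> \<in> L2h \<Omega> \<and> (\<forall>f\<in>L2h \<Omega>. f z = L2_inner \<Omega> f \<eta>)"

definition bergman_kernel ::
    "(complex^'n::finite) set \<Rightarrow> complex^'n \<Rightarrow> complex^'n \<Rightarrow> complex" where
  "bergman_kernel \<Omega> z \<xi> = cnj ((THE \<eta>. represents_evaluation \<Omega> z \<eta>) \<xi>)"

text \<open>On a domain the evaluation functionals are continuous, so the first conjunct always holds;
  it only records that the kernel is given by an actual representing function.\<close>

definition bergman_pseudometric_defined :: "(complex^'n::finite) set \<Rightarrow> bool" where
  "bergman_pseudometric_defined \<Omega> \<longleftrightarrow>
     (\<forall>z\<in>\<Omega>. (\<exists>!\<eta>. represents_evaluation \<Omega> z \<eta>) \<and>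
            bergman_kernel \<Omega> z z \<in> \<real> \<and> 0 < Re (bergman_kernel \<Omega> z z))"

definition bergman_coeff ::
    "(complex^'n::finite) set \<Rightarrow> 'n \<Rightarrow> 'n \<Rightarrow> complex^'n \<Rightarrow> complex" where
  "bergman_coeff \<Omega> i j =
     d_z i (d_zbar j (\<lambda>z. complex_of_real (ln (Re (bergman_kernel \<Omega> z z)))))"

definition bergman_form ::
    "(complex^'n::finite) set \<Rightarrow> complex^'n \<Rightarrow> complex^'n \<Rightarrow> complex^'n \<Rightarrow> complex" where
  "bergman_form \<Omega> z u v =
     2 * (\<Sum>i\<in>UNIV. \<Sum>j\<in>UNIV. bergman_coeff \<Omega> i j z * u $ i * cnj (v $ j))"

definition carries_bergman_metric :: "(complex^'n::finite) set \<Rightarrow> bool" where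
  "carries_bergman_metric \<Omega> \<longleftrightarrow>
     bergman_pseudometric_defined \<Omega> \<and>
     (\<forall>z\<in>\<Omega>. \<forall>v. v \<noteq> 0 \<longrightarrow> bergman_form \<Omega> z v v \<in> \<real> \<and> 0 < Re (bergman_form \<Omega> z v v))"


section \<open>Atlases\<close>

type_synonym ('a, 'b) chart = "'a set \<times> ('a \<Rightarrow> 'b)"
type_synonym ('a, 'b) geometry = "'a topology \<times> ('a, 'b) chart set"

text \<open>A chart is a homeomorphism from an open set of \<open>T\<close> onto an open set of the model space \<open>B\<close>;
  its values outside the open set are irrelevant. A predicate \<open>P W h\<close> says which maps \<open>h\<close> on an
  open set \<open>W\<close> of the model are admissible coordinate changes.\<close>

definition chart_on :: "'a topology \<Rightarrow> 'b topology \<Rightarrow> ('a, 'b) chart \<Rightarrow> bool" where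
  "chart_on T B = (\<lambda>(U, c). openin T U \<and> openin B (c ` U) \<and>
     homeomorphic_map (subtopology T U) (subtopology B (c ` U)) c)"

definition compatible ::
    "('b set \<Rightarrow> ('b \<Rightarrow> 'b) \<Rightarrow> bool) \<Rightarrow> ('a, 'b) chart \<Rightarrow> ('a, 'b) chart \<Rightarrow> bool" where
  "compatible P = (\<lambda>(U, c) (V, d).
     P (c ` (U \<inter> V)) (d \<circ> inv_into U c) \<and> P (d ` (U \<inter> V)) (c \<circ> inv_into V d))"

definition maximal_atlas ::
    "('b set \<Rightarrow> ('b \<Rightarrow> 'b) \<Rightarrow> bool) \<Rightarrow> 'b topology \<Rightarrow> ('a, 'b) geometry \<Rightarrow> bool" where
  "maximal_atlas P B = (\<lambda>(T, A).
     (\<forall>\<kappa>\<in>A. chart_on T B \<kappa>) \<and>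
     (\<Union>\<kappa>\<in>A. fst \<kappa>) = topspace T \<and>
     (\<forall>\<kappa>\<in>A. \<forall>\<kappa>'\<in>A. compatible P \<kappa> \<kappa>') \<and>
     (\<forall>\<kappa>. chart_on T B \<kappa> \<and> (\<forall>\<kappa>'\<in>A. compatible P \<kappa> \<kappa>') \<longrightarrow> \<kappa> \<in> A))"

definition geometric_iso ::
    "('b set \<Rightarrow> ('b \<Rightarrow> 'b) \<Rightarrow> bool) \<Rightarrow> ('a, 'b) geometry \<Rightarrow> ('c, 'b) geometry \<Rightarrow> ('a \<Rightarrow> 'c) \<Rightarrow> bool" where
  "geometric_iso P = (\<lambda>(T, A) (T', A') h.
     homeomorphic_map T T' h \<and>
     (\<forall>(U, c)\<in>A. \<forall>(V, d)\<in>A'. P (c ` {x\<in>U. h x \<in> V}) (d \<circ> h \<circ> inv_into U c)))"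


subsection \<open>Smooth oriented surfaces\<close>

primrec Ck_on :: "nat \<Rightarrow> complex set \<Rightarrow> (complex \<Rightarrow> complex) \<Rightarrow> bool" where
  "Ck_on 0 W h \<longleftrightarrow> continuous_on W h"
| "Ck_on (Suc k) W h \<longleftrightarrow>
     h differentiable_on W \<and> Ck_on k W (partial_deriv h 1) \<and> Ck_on k W (partial_deriv h \<i>)"

definition smooth_on :: "complex set \<Rightarrow> (complex \<Rightarrow> complex) \<Rightarrow> bool" where
  "smooth_on W h \<longleftrightarrow> (\<forall>k. Ck_on k W h)"

definition wirt :: "(complex \<Rightarrow> complex) \<Rightarrow> complex \<Rightarrow> complex" where
  "wirt h z = (partial_deriv h 1 z - \<i> * partial_deriv h \<i> z) / 2"

definition wirt_bar :: "(complex \<Rightarrow> complex) \<Rightarrow> complex \<Rightarrow> complex" where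
  "wirt_bar h z = (partial_deriv h 1 z + \<i> * partial_deriv h \<i> z) / 2"

text \<open>The Jacobian determinant of \<open>h\<close> is \<open>|h\<^sub>z|\<^sup>2 - |h\<^sub>\<zeta>|\<^sup>2\<close>, where \<open>\<zeta>\<close> is the conjugate of \<open>z\<close>.\<close>

definition orient_smooth :: "complex set \<Rightarrow> (complex \<Rightarrow> complex) \<Rightarrow> bool" where
  "orient_smooth W h \<longleftrightarrow>
     smooth_on W h \<and> (\<forall>z\<in>W. 0 < (cmod (wirt h z))\<^sup>2 - (cmod (wirt_bar h z))\<^sup>2)"

definition closed_oriented_surface :: "('a, complex) geometry \<Rightarrow> bool" where
  "closed_oriented_surface S \<longleftrightarrow>
     Hausdorff_space (fst S) \<and> compact_space (fst S) \<and> connected_space (fst S) \<and>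
     topspace (fst S) \<noteq> {} \<and> maximal_atlas orient_smooth euclidean S"

definition has_genus :: "('a, complex) geometry \<Rightarrow> nat \<Rightarrow> bool" where
  "has_genus S g \<longleftrightarrow> homology_group 1 (fst S) \<cong> free_Abelian_group {..<2 * g}"

text \<open>Isotopies are taken through homeomorphisms; for surfaces this gives the same relation on
  diffeomorphisms as isotopy through diffeomorphisms.\<close>

definition isotopic_to_id :: "'a topology \<Rightarrow> ('a \<Rightarrow> 'a) \<Rightarrow> bool" where
  "isotopic_to_id T h \<longleftrightarrow>
     (\<exists>F. continuous_map (prod_topology (top_of_set {0..1::real}) T) T F \<and>
          (\<forall>t\<in>{0..1}. homeomorphic_map T T (\<lambda>x. F (t, x))) \<and>
          (\<forall>x\<in>topspace T. F (0, x) = h x \<and> F (1, x) = x))"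


section \<open>Teichmueller space\<close>

definition riemann_surface :: "('a, complex) geometry \<Rightarrow> bool" where
  "riemann_surface X \<longleftrightarrow>
     Hausdorff_space (fst X) \<and> maximal_atlas (\<lambda>W h. h holomorphic_on W) euclidean X"

text \<open>Every Riemann surface diffeomorphic to \<open>S\<close> is isomorphic to one on the same carrier type, so
  it is no restriction to use the point type of \<open>S\<close> for all surfaces.\<close>

definition marked_riemann_surfaces ::
    "('a, complex) geometry \<Rightarrow> (('a, complex) geometry \<times> ('a \<Rightarrow> 'a)) set" where
  "marked_riemann_surfaces S =
     {(X, f). riemann_surface X \<and> geometric_iso orient_smooth S X f}"

definition teich_rel ::
    "('a, complex) geometry \<Rightarrow>
     ((('a, complex) geometry \<times> ('a \<Rightarrow> 'a)) \<times> (('a, complex) geometry \<times> ('a \<Rightarrow> 'a))) set" where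
  "teich_rel S = {((X, f), (Y, k)).
     (X, f) \<in> marked_riemann_surfaces S \<and> (Y, k) \<in> marked_riemann_surfaces S \<and>
     (\<exists>h. geometric_iso (\<lambda>W h. h holomorphic_on W) X Y h \<and>
          isotopic_to_id (fst S) (inv_into (topspace (fst S)) k \<circ> h \<circ> f))}"

definition teichmueller_space ::
    "('a, complex) geometry \<Rightarrow> (('a, complex) geometry \<times> ('a \<Rightarrow> 'a)) set set" where
  "teichmueller_space S = marked_riemann_surfaces S // teich_rel S"


subsection \<open>The base Riemann surface\<close>

definition upper_hp :: "complex set" where "upper_hp = {z. 0 < Im z}"
definition lower_hp :: "complex set" where "lower_hp = {z. Im z < 0}"

text \<open>A subgroup of \<open>PSL\<^sub>2(\<real>)\<close> is given by a subgroup of \<open>SL\<^sub>2(\<real>)\<close> that maps onto it.\<close>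

definition moeb_act :: "real^2^2 \<Rightarrow> complex \<Rightarrow> complex" where
  "moeb_act M = moebius (of_real (M$1$1)) (of_real (M$1$2)) (of_real (M$2$1)) (of_real (M$2$2))"

definition fuchsian_group :: "(real^2^2) set \<Rightarrow> bool" where
  "fuchsian_group \<Gamma> \<longleftrightarrow>
     (\<forall>M\<in>\<Gamma>. det M = 1) \<and> mat 1 \<in> \<Gamma> \<and> (\<forall>M\<in>\<Gamma>. \<forall>N\<in>\<Gamma>. M ** N \<in> \<Gamma>) \<and>
     (\<forall>M\<in>\<Gamma>. matrix_inv M \<in> \<Gamma>) \<and> discrete \<Gamma>"

text \<open>The base surface \<open>X\<^sub>0 = H/\<Gamma>\<close> marked by an orientation preserving diffeomorphism from \<open>S\<close>
  is encoded by the composition \<open>p\<^sub>0\<close> of the projection from the upper half-plane \<open>H\<close> to \<open>H/\<Gamma>\<close>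
  with the inverse of the marking. Its fibres are the \<open>\<Gamma>\<close>-orbits, and it is a local orientation
  preserving diffeomorphism: its local inverses are charts of \<open>S\<close>.\<close>

definition base_uniformization ::
    "('a, complex) geometry \<Rightarrow> (real^2^2) set \<Rightarrow> (complex \<Rightarrow> 'a) \<Rightarrow> bool" where
  "base_uniformization S \<Gamma> p\<^sub>0 \<longleftrightarrow>
     fuchsian_group \<Gamma> \<and>
     p\<^sub>0 ` upper_hp = topspace (fst S) \<and>
     (\<forall>z\<in>upper_hp. \<forall>z'\<in>upper_hp. p\<^sub>0 z = p\<^sub>0 z' \<longleftrightarrow> (\<exists>M\<in>\<Gamma>. z' = moeb_act M z)) \<and>
     (\<forall>z\<in>upper_hp. \<exists>W. open W \<and> z \<in> W \<and> W \<subseteq> upper_hp \<and> inj_on p\<^sub>0 W \<and>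
        (p\<^sub>0 ` W, inv_into W p\<^sub>0) \<in> snd S)"


subsection \<open>Beltrami differentials and quasiconformal maps\<close>

definition beltrami_differential :: "(real^2^2) set \<Rightarrow> (complex \<Rightarrow> complex) \<Rightarrow> bool" where
  "beltrami_differential \<Gamma> \<mu> \<longleftrightarrow>
     \<mu> \<in> borel_measurable lebesgue \<and>
     (\<exists>K. AE z in lebesgue. cmod (\<mu> z) \<le> K) \<and>
     (\<forall>z. z \<notin> upper_hp \<longrightarrow> \<mu> z = 0) \<and>
     (\<forall>M\<in>\<Gamma>. AE z in lebesgue. z \<in> upper_hp \<longrightarrow>
        \<mu> z = \<mu> (moeb_act M z) * cnj (deriv (moeb_act M) z) / deriv (moeb_act M) z)"

definition beltrami_coefficient :: "(real^2^2) set \<Rightarrow> (complex \<Rightarrow> complex) \<Rightarrow> bool" where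
  "beltrami_coefficient \<Gamma> \<mu> \<longleftrightarrow>
     beltrami_differential \<Gamma> \<mu> \<and> (\<exists>K<1. AE z in lebesgue. cmod (\<mu> z) \<le> K)"

definition locally_L2 :: "(complex \<Rightarrow> complex) \<Rightarrow> bool" where
  "locally_L2 u \<longleftrightarrow> u \<in> borel_measurable lebesgue \<and>
     (\<forall>K. compact K \<longrightarrow> set_integrable lebesgue K (\<lambda>z. (cmod (u z))\<^sup>2))"

definition test_function :: "(complex \<Rightarrow> complex) \<Rightarrow> bool" where
  "test_function \<psi> \<longleftrightarrow> smooth_on UNIV \<psi> \<and> (\<exists>K. compact K \<and> (\<forall>z. z \<notin> K \<longrightarrow> \<psi> z = 0))"

text \<open>\<open>u\<close> and \<open>v\<close> are the distributional derivatives of \<open>w\<close> with respect to \<open>z\<close> and to the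
  conjugate of \<open>z\<close>.\<close>

definition weak_wirtinger ::
    "(complex \<Rightarrow> complex) \<Rightarrow> (complex \<Rightarrow> complex) \<Rightarrow> (complex \<Rightarrow> complex) \<Rightarrow> bool" where
  "weak_wirtinger w u v \<longleftrightarrow> locally_L2 u \<and> locally_L2 v \<and>
     (\<forall>\<psi>. test_function \<psi> \<longrightarrow>
        (LINT z|lebesgue. w z * wirt \<psi> z) = - (LINT z|lebesgue. u z * \<psi> z) \<and>
        (LINT z|lebesgue. w z * wirt_bar \<psi> z) = - (LINT z|lebesgue. v z * \<psi> z))"

text \<open>The quasiconformal map of the sphere with Beltrami coefficient \<open>\<mu>\<close> fixing \<open>0\<close>, \<open>1\<close> and \<open>\<infinity>\<close>,
  given by its restriction to the plane.\<close>

definition normalized_qc :: "(complex \<Rightarrow> complex) \<Rightarrow> (complex \<Rightarrow> complex) \<Rightarrow> bool" where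
  "normalized_qc \<mu> w \<longleftrightarrow>
     (\<exists>w'. homeomorphism UNIV UNIV w w') \<and> w 0 = 0 \<and> w 1 = 1 \<and>
     (\<exists>u v. weak_wirtinger w u v \<and> (AE z in lebesgue. v z = \<mu> z * u z))"


subsection \<open>The Bers embedding\<close>

definition schwarzian :: "(complex \<Rightarrow> complex) \<Rightarrow> complex \<Rightarrow> complex" where
  "schwarzian h z =
     deriv (\<lambda>\<zeta>. deriv (deriv h) \<zeta> / deriv h \<zeta>) z - (deriv (deriv h) z / deriv h z)\<^sup>2 / 2"

definition quad_diffs :: "(real^2^2) set \<Rightarrow> (complex \<Rightarrow> complex) set" where
  "quad_diffs \<Gamma> = {q. q holomorphic_on lower_hp \<and> (\<forall>z. z \<notin> lower_hp \<longrightarrow> q z = 0) \<and>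
     (\<forall>M\<in>\<Gamma>. \<forall>z\<in>lower_hp. q (moeb_act M z) * (deriv (moeb_act M) z)\<^sup>2 = q z)}"

definition lower_schwarzian :: "(complex \<Rightarrow> complex) \<Rightarrow> complex \<Rightarrow> complex" where
  "lower_schwarzian w z = (if z \<in> lower_hp then schwarzian w z else 0)"

text \<open>\<open>\<mu>\<close> represents the marked Riemann surface \<open>(X, f)\<close>. The isomorphism of \<open>X\<close> with
  \<open>w(H)/w\<Gamma>w\<^sup>-\<^sup>1\<close> is given as a holomorphic map \<open>p\<close> from \<open>w(H)\<close> onto \<open>X\<close> whose fibres are the orbits
  of \<open>w\<Gamma>w\<^sup>-\<^sup>1\<close>. The marking induced by \<open>w\<close> sends \<open>p\<^sub>0 z\<close> to \<open>p (w z)\<close>.\<close>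

definition bers_representation ::
    "('a, complex) geometry \<Rightarrow> (real^2^2) set \<Rightarrow> (complex \<Rightarrow> 'a) \<Rightarrow>
     ('a, complex) geometry \<times> ('a \<Rightarrow> 'a) \<Rightarrow>
     (complex \<Rightarrow> complex) \<Rightarrow> (complex \<Rightarrow> complex) \<Rightarrow> (complex \<Rightarrow> 'a) \<Rightarrow> bool" where
  "bers_representation S \<Gamma> p\<^sub>0 = (\<lambda>(X, f) \<mu> w p.
     beltrami_coefficient \<Gamma> \<mu> \<and> normalized_qc \<mu> w \<and>
     continuous_map (top_of_set (w ` upper_hp)) (fst X) p \<and>
     p ` w ` upper_hp = topspace (fst X) \<and>
     (\<forall>z\<in>upper_hp. \<forall>z'\<in>upper_hp. p (w z) = p (w z') \<longleftrightarrow> (\<exists>M\<in>\<Gamma>. z' = moeb_act M z)) \<and>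
     (\<forall>(U, c)\<in>snd X. (c \<circ> p) holomorphic_on {\<zeta> \<in> w ` upper_hp. p \<zeta> \<in> U}) \<and>
     isotopic_to_id (fst S)
       (inv_into (topspace (fst S)) f \<circ> (\<lambda>x. p (w (inv_into upper_hp p\<^sub>0 x)))))"

definition bers_embedding ::
    "('a, complex) geometry \<Rightarrow> (real^2^2) set \<Rightarrow> (complex \<Rightarrow> 'a) \<Rightarrow>
     (('a, complex) geometry \<times> ('a \<Rightarrow> 'a)) set \<Rightarrow> complex \<Rightarrow> complex" where
  "bers_embedding S \<Gamma> p\<^sub>0 \<tau> =
     (THE q. \<exists>x\<in>\<tau>. \<exists>\<mu> w p. bers_representation S \<Gamma> p\<^sub>0 x \<mu> w p \<and> q = lower_schwarzian w)"

definition linear_coordinates ::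
    "(real^2^2) set \<Rightarrow> ((complex \<Rightarrow> complex) \<Rightarrow> complex^'n::finite) \<Rightarrow> bool" where
  "linear_coordinates \<Gamma> \<phi> \<longleftrightarrow>
     bij_betw \<phi> (quad_diffs \<Gamma>) UNIV \<and>
     (\<forall>q\<in>quad_diffs \<Gamma>. \<forall>r\<in>quad_diffs \<Gamma>. \<forall>a b.
        \<phi> (\<lambda>z. a * q z + b * r z) = a *s \<phi> q + b *s \<phi> r)"

definition teichmueller_domain ::
    "('a, complex) geometry \<Rightarrow> (real^2^2) set \<Rightarrow> (complex \<Rightarrow> 'a) \<Rightarrow>
     ((complex \<Rightarrow> complex) \<Rightarrow> complex^'n::finite) \<Rightarrow> (complex^'n) set" where
  "teichmueller_domain S \<Gamma> p\<^sub>0 \<phi> = (\<lambda>\<tau>. \<phi> (bers_embedding S \<Gamma> p\<^sub>0 \<tau>)) ` teichmueller_space S"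


section \<open>Projective structures\<close>

definition riemann_sphere :: "complex option topology" where
  "riemann_sphere = Alexandroff_compactification euclidean"

primrec moeb_sphere :: "complex^2^2 \<Rightarrow> complex option \<Rightarrow> complex option" where
  "moeb_sphere M None = (if M$2$1 = 0 then None else Some (M$1$1 / M$2$1))"
| "moeb_sphere M (Some z) =
     (if M$2$1 * z + M$2$2 = 0 then None
      else Some ((M$1$1 * z + M$1$2) / (M$2$1 * z + M$2$2)))"

text \<open>The Moebius transformation may differ between components of \<open>W\<close>.\<close>

definition locally_moebius ::
    "complex option set \<Rightarrow> (complex option \<Rightarrow> complex option) \<Rightarrow> bool" where
  "locally_moebius W h \<longleftrightarrow>
     (\<forall>x\<in>W. \<exists>M N. det M \<noteq> 0 \<and> openin riemann_sphere N \<and> x \<in> N \<and> (\<forall>y\<in>N \<inter> W. h y = moeb_sphere M y))"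

definition projective_structure :: "('a, complex option) geometry \<Rightarrow> bool" where
  "projective_structure \<sigma> \<longleftrightarrow>
     Hausdorff_space (fst \<sigma>) \<and> maximal_atlas locally_moebius riemann_sphere \<sigma>"

text \<open>The projective charts that avoid \<open>\<infinity>\<close> already form a holomorphic atlas.\<close>

definition underlying_surface :: "('a, complex option) geometry \<Rightarrow> ('a, complex) geometry" where
  "underlying_surface \<sigma> = (fst \<sigma>, {\<kappa>. chart_on (fst \<sigma>) euclidean \<kappa> \<and>
     (\<forall>(V, d)\<in>snd \<sigma>. None \<notin> d ` V \<longrightarrow>
        compatible (\<lambda>W h. h holomorphic_on W) \<kappa> (V, the \<circ> d))})"

definition marked_projective_structures ::
    "('a, complex) geometry \<Rightarrow> (('a, complex option) geometry \<times> ('a \<Rightarrow> 'a)) set" where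
  "marked_projective_structures S =
     {(\<sigma>, f). projective_structure \<sigma> \<and> geometric_iso orient_smooth S (underlying_surface \<sigma>) f}"

definition proj_rel ::
    "('a, complex) geometry \<Rightarrow>
     ((('a, complex option) geometry \<times> ('a \<Rightarrow> 'a)) \<times>
      (('a, complex option) geometry \<times> ('a \<Rightarrow> 'a))) set" where
  "proj_rel S = {((\<sigma>, f), (\<tau>, k)).
     (\<sigma>, f) \<in> marked_projective_structures S \<and> (\<tau>, k) \<in> marked_projective_structures S \<and>
     (\<exists>h. geometric_iso locally_moebius \<sigma> \<tau> h \<and>
          isotopic_to_id (fst S) (inv_into (topspace (fst S)) k \<circ> h \<circ> f))}"

definition projective_moduli ::
    "('a, complex) geometry \<Rightarrow> (('a, complex option) geometry \<times> ('a \<Rightarrow> 'a)) set set" where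
  "projective_moduli S = marked_projective_structures S // proj_rel S"

definition forgetful_map ::
    "('a, complex) geometry \<Rightarrow> (('a, complex option) geometry \<times> ('a \<Rightarrow> 'a)) set \<Rightarrow>
     (('a, complex) geometry \<times> ('a \<Rightarrow> 'a)) set" where
  "forgetful_map S c = teich_rel S `` ((\<lambda>(\<sigma>, f). (underlying_surface \<sigma>, f)) ` c)"

text \<open>The coefficient at \<open>x\<close> of the quadratic differential \<open>\<sigma> - \<sigma>\<^sub>0\<close> in the coordinate given by the
  chart \<open>(U, c)\<close> of \<open>\<sigma>\<^sub>0\<close>, assumed finite near \<open>x\<close>. It does not depend on the chart of \<open>\<sigma>\<close>.\<close>

definition structure_difference ::
    "('a, complex option) geometry \<Rightarrow> ('a, complex option) chart \<Rightarrow> 'a \<Rightarrow> complex" where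
  "structure_difference \<sigma> = (\<lambda>(U, c) x.
     THE s. \<forall>(V, d)\<in>snd \<sigma>. x \<in> V \<and> None \<notin> d ` V \<longrightarrow>
       s = schwarzian (\<lambda>\<zeta>. the (d (inv_into U c (Some \<zeta>)))) (the (c x)))"


section \<open>The canonical complex structure\<close>

text \<open>The Bers section is taken with respect to \<open>Y = X\<^sub>0\<close>. In the notation of
  \<^const>\<open>bers_representation\<close>, the simultaneous uniformization of \<open>X\<close> and \<open>X\<^sub>0\<close> is \<open>w\<Gamma>w\<^sup>-\<^sup>1\<close>,
  whose invariant domains \<open>w(H)\<close> and \<open>w(L)\<close> have quotients \<open>X\<close> and the mirror image of \<open>X\<^sub>0\<close>.
  So the charts of the Bers section at \<open>X\<close> are, up to Moebius transformations, the local
  inverses of \<open>p\<close>.\<close>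

definition bers_section ::
    "'a topology \<Rightarrow> complex set \<Rightarrow> (complex \<Rightarrow> 'a) \<Rightarrow> ('a, complex option) geometry" where
  "bers_section T D p = (T, {(U, c). chart_on T riemann_sphere (U, c) \<and>
     (\<forall>W. open W \<and> W \<subseteq> D \<and> inj_on p W \<longrightarrow>
        compatible locally_moebius (U, c) (p ` W, Some \<circ> inv_into W p))})"

text \<open>The quadratic differential \<open>\<sigma> - s(X)\<close>, where \<open>s\<close> is the Bers section, lifted to the
  invariant domain \<open>D\<close> covering \<open>X\<close>.\<close>

definition lifted_difference ::
    "('a, complex option) geometry \<Rightarrow> complex set \<Rightarrow> (complex \<Rightarrow> 'a) \<Rightarrow> complex \<Rightarrow> complex" where
  "lifted_difference \<sigma> D p \<zeta> =
     (THE s. \<forall>W. open W \<and> \<zeta> \<in> W \<and> W \<subseteq> D \<and> inj_on p W \<and>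
        (p ` W, Some \<circ> inv_into W p) \<in> snd (bers_section (fst \<sigma>) D p) \<longrightarrow>
        s = structure_difference \<sigma> (p ` W, Some \<circ> inv_into W p) (p \<zeta>))"

text \<open>\<open>v\<close> is the tangent vector, in the coordinates \<open>\<phi>\<close> of the Bers embedding, of the complex
  curve represented by \<open>\<mu> + t\<nu>\<close> at \<open>t = 0\<close>.\<close>

definition bers_tangent ::
    "(real^2^2) set \<Rightarrow> ((complex \<Rightarrow> complex) \<Rightarrow> complex^'n::finite) \<Rightarrow>
     (complex \<Rightarrow> complex) \<Rightarrow> (complex \<Rightarrow> complex) \<Rightarrow> complex^'n \<Rightarrow> bool" where
  "bers_tangent \<Gamma> \<phi> \<mu> \<nu> v \<longleftrightarrow>
     (\<exists>\<omega>. (\<forall>\<^sub>F t in nhds 0. beltrami_coefficient \<Gamma> (\<lambda>z. \<mu> z + t * \<nu> z) \<and>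
              normalized_qc (\<lambda>z. \<mu> z + t * \<nu> z) (\<omega> t)) \<and>
          (\<forall>i. ((\<lambda>t. \<phi> (lower_schwarzian (\<omega> t)) $ i) has_field_derivative v $ i) (at 0)))"

text \<open>\<open>\<xi>\<close> is the covector at the point represented by \<open>\<mu>\<close>, in the coordinates dual to \<open>\<phi>\<close>, that
  corresponds to the quadratic differential \<open>\<theta>\<close> on \<open>w(H)\<close>. On \<open>X\<close> the variation \<open>\<nu>\<close> of \<open>\<mu>\<close> is the
  Beltrami differential \<open>\<nu> / (1 - |\<mu>|\<^sup>2) * w\<^sub>z / cnj w\<^sub>z\<close> transported by \<open>w\<close>, and the area
  element is multiplied by \<open>|w\<^sub>z|\<^sup>2 (1 - |\<mu>|\<^sup>2)\<close>; hence its pairing with \<open>\<theta>\<close> is the integral of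
  \<open>\<theta>(w) w\<^sub>z\<^sup>2 \<nu>\<close> over a fundamental set of \<open>\<Gamma>\<close>.\<close>

definition represents_covector ::
    "('a, complex) geometry \<Rightarrow> (real^2^2) set \<Rightarrow> (complex \<Rightarrow> 'a) \<Rightarrow>
     ((complex \<Rightarrow> complex) \<Rightarrow> complex^'n::finite) \<Rightarrow>
     (complex \<Rightarrow> complex) \<Rightarrow> (complex \<Rightarrow> complex) \<Rightarrow> (complex \<Rightarrow> complex) \<Rightarrow> complex^'n \<Rightarrow> bool" where
  "represents_covector S \<Gamma> p\<^sub>0 \<phi> \<mu> w \<theta> \<xi> \<longleftrightarrow>
     (\<forall>\<nu> v F u u'. beltrami_differential \<Gamma> \<nu> \<and> bers_tangent \<Gamma> \<phi> \<mu> \<nu> v \<and>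
        F \<in> sets lebesgue \<and> F \<subseteq> upper_hp \<and> bij_betw p\<^sub>0 F (topspace (fst S)) \<and>
        weak_wirtinger w u u' \<longrightarrow>
        (\<Sum>i\<in>UNIV. \<xi> $ i * v $ i) = (LINT z:F|lebesgue. \<theta> (w z) * (u z)\<^sup>2 * \<nu> z))"

text \<open>The bijection of the moduli space of projective structures with the cotangent bundle of
  Teichmueller space, written in the coordinates of the Bers embedding. The components indexed by
  \<open>Inl\<close> are those of the base point, the ones indexed by \<open>Inr\<close> those of the covector.\<close>

definition canonical_chart ::
    "('a, complex) geometry \<Rightarrow> (real^2^2) set \<Rightarrow> (complex \<Rightarrow> 'a) \<Rightarrow>
     ((complex \<Rightarrow> complex) \<Rightarrow> complex^'n::finite) \<Rightarrow>
     (('a, complex option) geometry \<times> ('a \<Rightarrow> 'a)) set \<Rightarrow> complex^('n + 'n)" where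
  "canonical_chart S \<Gamma> p\<^sub>0 \<phi> c =
     (THE x. (\<chi> i. x $ Inl i) = \<phi> (bers_embedding S \<Gamma> p\<^sub>0 (forgetful_map S c)) \<and>
        (\<exists>(\<sigma>, f)\<in>c. \<exists>\<mu> w p. bers_representation S \<Gamma> p\<^sub>0 (underlying_surface \<sigma>, f) \<mu> w p \<and>
           represents_covector S \<Gamma> p\<^sub>0 \<phi> \<mu> w (lifted_difference \<sigma> (w ` upper_hp) p)
             (\<chi> i. x $ Inr i)))"

definition sev_holomorphic_map ::
    "(complex^'m::finite \<Rightarrow> complex^'n::finite) \<Rightarrow> (complex^'m) set \<Rightarrow> bool" where
  "sev_holomorphic_map F \<Omega> \<longleftrightarrow> (\<forall>i. sev_holomorphic_on (\<lambda>z. F z $ i) \<Omega>)"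

text \<open>\<open>\<Phi>\<close> is a biholomorphism from the moduli space of projective structures, with the complex
  structure that makes \<^const>\<open>canonical_chart\<close> a biholomorphism, onto \<open>\<Omega>\<close>.\<close>

definition canonical_biholomorphism ::
    "('a, complex) geometry \<Rightarrow> (real^2^2) set \<Rightarrow> (complex \<Rightarrow> 'a) \<Rightarrow>
     ((complex \<Rightarrow> complex) \<Rightarrow> complex^'n::finite) \<Rightarrow> (complex^('n + 'n)) set \<Rightarrow>
     ((('a, complex option) geometry \<times> ('a \<Rightarrow> 'a)) set \<Rightarrow> complex^('n + 'n)) \<Rightarrow> bool" where
  "canonical_biholomorphism S \<Gamma> p\<^sub>0 \<phi> \<Omega> \<Phi> \<longleftrightarrow>
     bij_betw \<Phi> (projective_moduli S) \<Omega> \<and>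
     (\<exists>F G. sev_holomorphic_map F (canonical_chart S \<Gamma> p\<^sub>0 \<phi> ` projective_moduli S) \<and>
            sev_holomorphic_map G \<Omega> \<and>
            (\<forall>c\<in>projective_moduli S.
               \<Phi> c = F (canonical_chart S \<Gamma> p\<^sub>0 \<phi> c) \<and> canonical_chart S \<Gamma> p\<^sub>0 \<phi> c = G (\<Phi> c)))"

text \<open>The domain \<open>\<T>(S) \<times> \<complex>\<^sup>3\<^sup>g\<^sup>-\<^sup>3\<close> in \<open>\<complex>\<^sup>6\<^sup>g\<^sup>-\<^sup>6\<close>, where \<open>'n\<close> has \<open>3g - 3\<close> elements.\<close>

definition moduli_domain ::
    "('a, complex) geometry \<Rightarrow> (real^2^2) set \<Rightarrow> (complex \<Rightarrow> 'a) \<Rightarrow>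
     ((complex \<Rightarrow> complex) \<Rightarrow> complex^'n::finite) \<Rightarrow> (complex^('n + 'n)) set" where
  "moduli_domain S \<Gamma> p\<^sub>0 \<phi> = {x. (\<chi> i. x $ Inl i) \<in> teichmueller_domain S \<Gamma> p\<^sub>0 \<phi>}"

end

theory Submission
  imports Defs
begin

text \<open>Two facts carry the theorem: square integrable holomorphic functions vanish on a domain that
  is a union of parallel complex lines, and Teichmueller space is not empty.

  Let \<open>\<Omega>\<close> be invariant under translation in the \<open>k\<close>-th coordinate direction, let \<open>f\<close> be holomorphic
  and square integrable on \<open>\<Omega>\<close>, and set \<open>u = |f|\<^sup>2\<close>. On each line \<open>z + \<complex>e\<^sub>k\<close> the function \<open>f\<close> is
  entire, so \<open>u(z)\<close> is at most the mean of \<open>u\<close> over the circle of radius \<open>R\<close> around \<open>z\<close> in that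
  line. Integrating over the slab \<open>|z\<^sub>k| \<le> a\<close> and exchanging the integrals, each point of the circle
  contributes the integral of \<open>u\<close> over a translate of the slab, which lies in \<open>|z\<^sub>k| \<ge> R - a\<close>.
  Thus the mass of \<open>u\<close> on the slab is bounded by its tail, which tends to \<open>0\<close> as \<open>R\<close> grows, and
  \<open>f = 0\<close> almost everywhere. In particular the representing function \<open>\<eta>\<^sub>z\<close> satisfies
  \<open>\<eta>\<^sub>z(z) = \<langle>\<eta>\<^sub>z, \<eta>\<^sub>z\<rangle> = 0\<close>, so \<open>k(z,z)\<close> is not positive at any point \<open>z\<close> of \<open>\<Omega>\<close>.

  The moduli domain is such a union of lines, because its covector coordinates are unrestricted.
  It has to be shown nonempty, since over the empty set every positivity condition would hold
  vacuously, and for this it suffices to exhibit a point of Teichmueller space. Such a point is the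
  base surface: the local inverses of the uniformization \<open>p\<^sub>0\<close> differ by Moebius transformations,
  hence generate a holomorphic atlas, and for it the identity is a marking since holomorphic
  injections preserve smoothness and orientation.\<close>

section \<open>Square integrable holomorphic functions on unions of parallel lines\<close>

text \<open>Cauchy's formula for \<open>g\<^sup>2\<close>, which is holomorphic as well, gives the sub-mean value property
  of \<open>|g|\<^sup>2\<close>.\<close>

lemma circle_mean_bound:
  assumes "g holomorphic_on UNIV" "R > 0"
  shows "ennreal ((cmod (g 0))\<^sup>2) \<le>
    (\<integral>\<^sup>+ t. ennreal ((cmod (g (of_real R * exp (2 * of_real pi * \<i> * of_real t))))\<^sup>2) * indicator {0..1} t \<partial>lborel)"
proof -
  define e where "e = (\<lambda>t::real. of_real R * exp (2 * of_real pi * \<i> * of_real t) :: complex)"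
  have ce: "continuous_on A e" for A
    unfolding e_def by (intro continuous_intros)
  have cg: "continuous_on UNIV g"
    using assms(1) by (rule holomorphic_on_imp_continuous_on)
  have cge: "continuous_on A (\<lambda>t. g (e t))" for A
    by (rule continuous_on_compose2[OF cg ce]) auto
  have hol: "(\<lambda>u. (g u)\<^sup>2) holomorphic_on cball 0 R"
    using assms(1) by (intro holomorphic_intros) (auto intro: holomorphic_on_subset)
  have "((\<lambda>u. (g u)\<^sup>2 / (u - 0)) has_contour_integral (2 * of_real pi * \<i> * (g 0)\<^sup>2)) (circlepath 0 R)"
    using Cauchy_integral_circlepath_simple[OF hol, of 0] assms(2) by simp
  then have "((\<lambda>t. (g (e t))\<^sup>2 / e t * (2 * of_real pi * \<i> * e t)) has_integral (2 * of_real pi * \<i> * (g 0)\<^sup>2)) {0..1}"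
    unfolding has_contour_integral_def
    by (rule has_integral_eq[rotated])
       (auto simp: vector_derivative_circlepath01 circlepath[THEN fun_cong] e_def)
  moreover have "(g (e t))\<^sup>2 / e t * (2 * of_real pi * \<i> * e t) = (2 * of_real pi * \<i>) * (g (e t))\<^sup>2" for t
    using assms(2) by (simp add: e_def)
  ultimately have "((\<lambda>t. (2 * of_real pi * \<i>) * (g (e t))\<^sup>2) has_integral (2 * of_real pi * \<i> * (g 0)\<^sup>2)) {0..1}"
    by simp
  from has_integral_mult_right[OF this, of "1 / (2 * of_real pi * \<i>)"]
  have int: "((\<lambda>t. (g (e t))\<^sup>2) has_integral (g 0)\<^sup>2) {0..1}"
    by simp
  have int2: "(\<lambda>t. (cmod (g (e t)))\<^sup>2) integrable_on {0..1}"
    by (intro integrable_continuous_real continuous_intros cge)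
  have "(cmod (g 0))\<^sup>2 = cmod (integral {0..1} (\<lambda>t. (g (e t))\<^sup>2))"
    using int by (simp add: integral_unique norm_power)
  also have "\<dots> \<le> integral {0..1} (\<lambda>t. (cmod (g (e t)))\<^sup>2)"
    using int int2 by (intro integral_norm_bound_integral) (auto simp: norm_power)
  finally have le: "(cmod (g 0))\<^sup>2 \<le> integral {0..1} (\<lambda>t. (cmod (g (e t)))\<^sup>2)" .
  have "(\<integral>\<^sup>+ t. ennreal ((cmod (g (e t)))\<^sup>2) * indicator {0..1} t \<partial>lborel)
      = ennreal (integral {0..1} (\<lambda>t. (cmod (g (e t)))\<^sup>2))"
  proof (rule nn_integral_has_integral_lebesgue')
    show "((\<lambda>t. (cmod (g (e t)))\<^sup>2) has_integral integral {0..1} (\<lambda>t. (cmod (g (e t)))\<^sup>2)) {0..1}"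
      using int2 by (rule integrable_integral)
  qed auto
  with le show ?thesis
    unfolding e_def by (simp add: ennreal_leI)
qed

lemma holomorphic_along_line:
  fixes f :: "complex^'m::finite \<Rightarrow> complex"
  assumes "sev_holomorphic_on f \<Omega>" "\<And>t. z + t *s v \<in> \<Omega>"
  shows "(\<lambda>t. f (z + t *s v)) holomorphic_on UNIV"
  unfolding holomorphic_on_def
proof
  fix t :: complex
  obtain f' where f': "(f has_derivative f') (at (z + t *s v) within \<Omega>)" "\<And>c v. f' (c *s v) = c * f' v"
    using assms unfolding sev_holomorphic_on_def by metis
  have lin: "bounded_linear (\<lambda>t. t *s v)"
    by (intro linear_conv_bounded_linear[THEN iffD1] linearI) (auto simp: vec_eq_iff algebra_simps)
  have "((\<lambda>t. z + t *s v) has_derivative (\<lambda>t. t *s v)) (at t)"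
    using has_derivative_add[OF has_derivative_const bounded_linear_imp_has_derivative[OF lin]] by simp
  then have "((\<lambda>t. f (z + t *s v)) has_derivative (\<lambda>t. f' (t *s v))) (at t)"
    by (rule has_derivative_in_compose[where s=UNIV, simplified])
       (use f' assms(2) in \<open>auto intro: has_derivative_subset\<close>)
  moreover have "(\<lambda>t. f' (t *s v)) = (*) (f' v)"
    using f'(2) by (simp add: fun_eq_iff)
  ultimately show "(\<lambda>t. f (z + t *s v)) field_differentiable at t within UNIV"
    unfolding field_differentiable_def has_field_derivative_def by auto
qed

lemma L2h_integrable:
  assumes "f \<in> L2h \<Omega>"
  shows "integrable lborel (\<lambda>z. (cmod (f z))\<^sup>2)"
proof -
  have "(\<lambda>z. indicator \<Omega> z *\<^sub>R (cmod (f z))\<^sup>2) = (\<lambda>z. (cmod (f z))\<^sup>2)"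
    using assms by (auto simp: L2h_def indicator_def fun_eq_iff)
  then show ?thesis
    using assms by (simp add: L2h_def set_integrable_def)
qed

text \<open>The mass of \<open>|f|\<^sup>2\<close> on a slab around the hyperplane \<open>z\<^sub>k = 0\<close> is bounded by its tail, through
  translation invariance of the measure and Tonelli's theorem for the pair of a point \<open>z\<close> and an
  angle. This replaces a decomposition of the measure along the coordinates.\<close>

lemma L2h_line_invariant_nn_integral_zero:
  fixes \<Omega> :: "(complex^'m::finite) set"
  assumes inv: "\<And>z t. z \<in> \<Omega> \<Longrightarrow> z + t *s axis k 1 \<in> \<Omega>" and f: "f \<in> L2h \<Omega>"
  shows "(\<integral>\<^sup>+ z. ennreal ((cmod (f z))\<^sup>2) \<partial>lborel) = 0"
proof -
  define u where "u z = ennreal ((cmod (f z))\<^sup>2)" for z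
  have hol: "sev_holomorphic_on f \<Omega>" and zero: "\<And>z. z \<notin> \<Omega> \<Longrightarrow> f z = 0"
    using f by (auto simp: L2h_def)
  have int: "integrable lborel (\<lambda>z. (cmod (f z))\<^sup>2)"
    using f by (rule L2h_integrable)
  then have meas: "(\<lambda>z. (cmod (f z))\<^sup>2) \<in> borel_measurable lborel"
    by auto
  then have mu[measurable]: "u \<in> borel_measurable borel"
    unfolding u_def by simp
  have cyl[measurable]: "{z::complex^'m. a \<le> cmod (z $ k)} \<in> sets borel"
       "{z::complex^'m. cmod (z $ k) \<le> a} \<in> sets borel" for a
    by (auto intro!: borel_closed closed_Collect_le continuous_intros)
  \<comment> \<open>Mean values over circles of radius \<open>R\<close> push the slab out to distance at least \<open>R - a\<close>.\<close>
  have bound: "(\<integral>\<^sup>+ z. u z * indicator {z. cmod (z $ k) \<le> a} z \<partial>lborel) \<le>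
      (\<integral>\<^sup>+ z. u z * indicator {z. R - a \<le> cmod (z $ k)} z \<partial>lborel)" if "R > 0" for a R
  proof -
    define e where "e t = (of_real R * exp (2 * of_real pi * \<i> * of_real t)) *s axis k 1" for t :: real
    have ek: "e t $ k = of_real R * exp (2 * of_real pi * \<i> * of_real t)" for t
      by (simp add: e_def)
    have ne: "cmod (e t $ k) = R" for t
      using that by (simp add: ek norm_mult)
    have "continuous_on UNIV (\<lambda>t. e t)"
      unfolding e_def vector_scalar_mult_def by (intro continuous_intros)
    then have me[measurable]: "e \<in> borel_measurable borel"
      by (rule borel_measurable_continuous_onI)
    have mean: "u z \<le> (\<integral>\<^sup>+ t. u (z + e t) * indicator {0..1} t \<partial>lborel)" for z
    proof (cases "z \<in> \<Omega>")
      case True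
      have "(\<lambda>t. f (z + t *s axis k 1)) holomorphic_on UNIV"
        by (rule holomorphic_along_line[OF hol inv[OF True]])
      from circle_mean_bound[OF this that] show ?thesis
        by (simp add: u_def e_def)
    qed (simp add: u_def zero)
    have "(\<integral>\<^sup>+ z. u z * indicator {z. cmod (z $ k) \<le> a} z \<partial>lborel) \<le>
        (\<integral>\<^sup>+ z. (\<integral>\<^sup>+ t. u (z + e t) * indicator {0..1} t \<partial>lborel) * indicator {z. cmod (z $ k) \<le> a} z \<partial>lborel)"
      by (intro nn_integral_mono mult_right_mono mean) auto
    also have "\<dots> = (\<integral>\<^sup>+ z. (\<integral>\<^sup>+ t. u (z + e t) * indicator {0..1} t * indicator {z. cmod (z $ k) \<le> a} z \<partial>lborel) \<partial>lborel)"
      by (subst nn_integral_multc) auto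
    also have "\<dots> = (\<integral>\<^sup>+ t. (\<integral>\<^sup>+ z. u (z + e t) * indicator {0..1} t * indicator {z. cmod (z $ k) \<le> a} z \<partial>lborel) \<partial>lborel)"
      by (rule lborel_pair.Fubini'[symmetric]) measurable
    also have "\<dots> \<le> (\<integral>\<^sup>+ t. (\<integral>\<^sup>+ z. u (z + e t) * indicator {z. R - a \<le> cmod (z $ k)} (z + e t) \<partial>lborel) * indicator {0..1::real} t \<partial>lborel)"
    proof (subst nn_integral_multc[symmetric], measurable, intro nn_integral_mono)
      fix t :: real and z :: "complex^'m"
      have "R - a \<le> cmod ((z + e t) $ k)" if "cmod (z $ k) \<le> a"
        using that ne[of t] norm_triangle_ineq2[of "e t $ k" "- (z $ k)"] by (simp add: add.commute)
      then show "u (z + e t) * indicator {0..1} t * indicator {z. cmod (z $ k) \<le> a} z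
          \<le> u (z + e t) * indicator {z. R - a \<le> cmod (z $ k)} (z + e t) * indicator {0..1} t"
        by (auto simp: indicator_def)
    qed
    also have "\<dots> = (\<integral>\<^sup>+ t. (\<integral>\<^sup>+ z. u z * indicator {z. R - a \<le> cmod (z $ k)} z \<partial>lborel) * indicator {0..1::real} t \<partial>lborel)"
    proof -
      have "(\<integral>\<^sup>+ z. u (z + c) * indicator {z. R - a \<le> cmod (z $ k)} (z + c) \<partial>lborel)
          = (\<integral>\<^sup>+ z. u z * indicator {z. R - a \<le> cmod (z $ k)} z \<partial>lborel)" for c
      proof -
        have "(\<integral>\<^sup>+ z. u z * indicator {z. R - a \<le> cmod (z $ k)} z \<partial>lborel) =
          (\<integral>\<^sup>+ z. u z * indicator {z. R - a \<le> cmod (z $ k)} z \<partial>distr lborel borel ((+) c))"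
          by (simp add: lborel_distr_plus)
        also have "\<dots> = (\<integral>\<^sup>+ z. u (c + z) * indicator {z. R - a \<le> cmod (z $ k)} (c + z) \<partial>lborel)"
          by (rule nn_integral_distr) measurable
        finally show ?thesis by (simp add: add.commute)
      qed
      then show ?thesis by simp
    qed
    also have "\<dots> = (\<integral>\<^sup>+ z. u z * indicator {z. R - a \<le> cmod (z $ k)} z \<partial>lborel)"
      by (simp add: nn_integral_cmult)
    finally show ?thesis .
  qed
  have tail: "(\<lambda>n. \<integral>\<^sup>+ z. u z * indicator {z. real n \<le> cmod (z $ k)} z \<partial>lborel) \<longlonglongrightarrow> 0"
  proof -
    have fin: "(\<integral>\<^sup>+ z. u z \<partial>lborel) < \<infinity>"
      using int unfolding u_def integrable_iff_bounded by simp
    have "(\<lambda>n. \<integral>\<^sup>+ z. u z * indicator {z. real n \<le> cmod (z $ k)} z \<partial>lborel) \<longlonglongrightarrow> (\<integral>\<^sup>+ (z::complex^'m). 0 \<partial>lborel)"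
    proof (rule nn_integral_dominated_convergence[where w=u])
      show "AE z in lborel. (\<lambda>n. u z * indicator {z. real n \<le> cmod (z $ k)} z) \<longlonglongrightarrow> 0"
      proof (rule AE_I2, rule tendsto_eventually)
        fix z :: "complex^'m"
        show "\<forall>\<^sub>F n in sequentially. u z * indicator {z. real n \<le> cmod (z $ k)} z = 0"
          using eventually_gt_at_top[of "nat \<lceil>cmod (z $ k)\<rceil>"]
          by eventually_elim (auto simp: indicator_def, linarith)
      qed
    next
      show "AE z in lborel. u z * indicator {z. real n \<le> cmod (z $ k)} z \<le> u z" for n
        by (auto simp: indicator_def)
    qed (use fin in auto)
    then show ?thesis by simp
  qed
  have slab: "(\<integral>\<^sup>+ z. u z * indicator {z. cmod (z $ k) \<le> real m} z \<partial>lborel) = 0" for m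
  proof -
    have "(\<integral>\<^sup>+ z. u z * indicator {z. cmod (z $ k) \<le> real m} z \<partial>lborel) \<le>
        (\<integral>\<^sup>+ z. u z * indicator {z. real n \<le> cmod (z $ k)} z \<partial>lborel)" if "n > 0" for n
      using bound[of "real n + real m" "real m"] that by simp
    then have "(\<integral>\<^sup>+ z. u z * indicator {z. cmod (z $ k) \<le> real m} z \<partial>lborel) \<le> 0"
      by (intro tendsto_lowerbound[OF tail])
         (auto intro!: eventually_sequentiallyI[of 1])
    then show ?thesis by simp
  qed
  have "AE z in lborel. \<forall>m. u z * indicator {z. cmod (z $ k) \<le> real m} z = 0"
    using slab by (subst AE_all_countable) (simp add: nn_integral_0_iff_AE)
  then have "AE z in lborel. u z = 0"
  proof eventually_elim
    case (elim z)
    obtain m where "cmod (z $ k) \<le> real m" using real_arch_simple by blast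
    with elim[rule_format, of m] show ?case by (simp add: indicator_def)
  qed
  then show ?thesis
    by (simp add: nn_integral_0_iff_AE flip: u_def)
qed

text \<open>The representing function of the evaluation at \<open>z\<close> vanishes at \<open>z\<close>, as its value there is
  the square of its norm. The reproducing property thus turns vanishing almost everywhere into
  vanishing at \<open>z\<close>, without an appeal to continuity.\<close>

lemma line_invariant_no_bergman_pseudometric:
  fixes \<Omega> :: "(complex^'m::finite) set"
  assumes inv: "\<And>z t. z \<in> \<Omega> \<Longrightarrow> z + t *s axis k 1 \<in> \<Omega>" and "\<Omega> \<noteq> {}"
  shows "\<not> bergman_pseudometric_defined \<Omega>"
proof
  assume def: "bergman_pseudometric_defined \<Omega>"
  obtain z where z: "z \<in> \<Omega>" using assms by auto
  define \<eta> where "\<eta> = (THE \<eta>. represents_evaluation \<Omega> z \<eta>)"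
  have ex: "\<exists>!\<eta>. represents_evaluation \<Omega> z \<eta>" and pos: "0 < Re (bergman_kernel \<Omega> z z)"
    using def z by (auto simp: bergman_pseudometric_defined_def)
  have rep: "represents_evaluation \<Omega> z \<eta>"
    unfolding \<eta>_def by (rule theI'[OF ex])
  then have \<eta>: "\<eta> \<in> L2h \<Omega>" and ev: "\<eta> z = L2_inner \<Omega> \<eta> \<eta>"
    by (auto simp: represents_evaluation_def)
  have meas: "(\<lambda>z. (cmod (\<eta> z))\<^sup>2) \<in> borel_measurable lborel"
    using L2h_integrable[OF \<eta>] by auto
  have "AE \<xi> in lborel. ennreal ((cmod (\<eta> \<xi>))\<^sup>2) = 0"
    using L2h_line_invariant_nn_integral_zero[where k=k, OF _ \<eta>] inv meas by (subst (asm) nn_integral_0_iff_AE) auto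
  then have "AE \<xi> in lborel. indicator \<Omega> \<xi> *\<^sub>R (\<eta> \<xi> * cnj (\<eta> \<xi>)) = 0"
    by eventually_elim (simp add: ennreal_eq_0_iff)
  then have "L2_inner \<Omega> \<eta> \<eta> = 0"
    unfolding L2_inner_def set_lebesgue_integral_def by (rule integral_eq_zero_AE)
  with ev pos show False
    by (simp add: bergman_kernel_def flip: \<eta>_def)
qed

section \<open>Smooth maps and holomorphic coordinate changes\<close>

lemma partial_deriv_eq_derivative:
  assumes "(h has_derivative h') (at z)"
  shows "partial_deriv h e z = h' e"
proof -
  have "((\<lambda>t::real. z + t *\<^sub>R e) has_derivative (\<lambda>t. t *\<^sub>R e)) (at 0)"
    by (auto intro!: derivative_eq_intros)
  then have "((\<lambda>t::real. h (z + t *\<^sub>R e)) has_derivative (\<lambda>t. h' (t *\<^sub>R e))) (at 0)"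
    using diff_chain_at[of "\<lambda>t::real. z + t *\<^sub>R e" _ 0 h h'] assms by (simp add: o_def)
  moreover have "h' (t *\<^sub>R e) = t *\<^sub>R h' e" for t
    using assms by (simp add: has_derivative_def bounded_linear.linear linear_scale)
  ultimately have "((\<lambda>t::real. h (z + t *\<^sub>R e)) has_vector_derivative h' e) (at 0)"
    by (simp add: has_vector_derivative_def)
  then show ?thesis
    unfolding partial_deriv_def by (rule vector_derivative_at)
qed

lemma partial_deriv_cong:
  assumes "open W" "z \<in> W" "\<And>z. z \<in> W \<Longrightarrow> f z = g z"
  shows "partial_deriv f e z = partial_deriv g e z"
proof -
  have "open ((\<lambda>t::real. z + t *\<^sub>R e) -` W)"
    by (intro open_vimage assms(1) continuous_intros)
  then have "\<forall>\<^sub>F t in nhds (0::real). t \<in> (\<lambda>t. z + t *\<^sub>R e) -` W"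
    using assms(2) by (intro eventually_nhds_in_open) auto
  then have "\<forall>\<^sub>F t in nhds (0::real). t \<in> UNIV \<longrightarrow> f (z + t *\<^sub>R e) = g (z + t *\<^sub>R e)"
    by eventually_elim (use assms(3) in auto)
  then show ?thesis
    unfolding partial_deriv_def by (rule vector_derivative_cong_eq) auto
qed

lemma partial_deriv_add:
  assumes "f differentiable at z" "g differentiable at z"
  shows "partial_deriv (\<lambda>z. f z + g z) e z = partial_deriv f e z + partial_deriv g e z"
proof -
  from assms obtain f' g' where "(f has_derivative f') (at z)" "(g has_derivative g') (at z)"
    by (auto simp: differentiable_def)
  then show ?thesis
    by (simp add: partial_deriv_eq_derivative partial_deriv_eq_derivative[OF has_derivative_add])
qed

lemma partial_deriv_mult:
  assumes "f differentiable at z" "g differentiable at z"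
  shows "partial_deriv (\<lambda>z. f z * g z) e z = f z * partial_deriv g e z + partial_deriv f e z * g z"
proof -
  from assms obtain f' g' where "(f has_derivative f') (at z)" "(g has_derivative g') (at z)"
    by (auto simp: differentiable_def)
  then show ?thesis
    by (simp add: partial_deriv_eq_derivative partial_deriv_eq_derivative[OF has_derivative_mult])
qed

lemma partial_deriv_holomorphic_compose:
  assumes "h differentiable at z" "F holomorphic_on V" "open V" "h z \<in> V"
  shows "partial_deriv (\<lambda>z. F (h z)) e z = deriv F (h z) * partial_deriv h e z"
proof -
  from assms(1) obtain h' where h': "(h has_derivative h') (at z)"
    by (auto simp: differentiable_def)
  have "(F has_derivative (*) (deriv F (h z))) (at (h z))"
    using holomorphic_derivI[OF assms(2-4)] by (simp add: has_field_derivative_def)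
  from diff_chain_at[OF h' this] h' show ?thesis
    by (simp add: partial_deriv_eq_derivative o_def)
qed

lemma Ck_on_subset: "Ck_on k W f \<Longrightarrow> V \<subseteq> W \<Longrightarrow> Ck_on k V f"
  by (induction k arbitrary: f) (auto intro: continuous_on_subset differentiable_on_subset)

lemma Ck_on_Suc_imp: "Ck_on (Suc k) W f \<Longrightarrow> Ck_on k W f"
proof (induction k arbitrary: f)
  case 0
  then show ?case by (simp add: differentiable_imp_continuous_on)
next
  case (Suc k)
  then have "f differentiable_on W" "Ck_on (Suc k) W (partial_deriv f 1)" "Ck_on (Suc k) W (partial_deriv f \<i>)"
    by (simp_all only: Ck_on.simps(2)[of "Suc k" W f])
  then show ?case
    using Suc.IH by (simp only: Ck_on.simps(2)[of k W f])
qed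

lemma Ck_on_cong:
  assumes "open W" "\<And>z. z \<in> W \<Longrightarrow> f z = g z" "Ck_on k W f"
  shows "Ck_on k W g"
  using assms(2,3)
proof (induction k arbitrary: f g)
  case 0
  then show ?case by (auto cong: continuous_on_cong)
next
  case (Suc k)
  have "Ck_on k W (partial_deriv g e)" if "Ck_on k W (partial_deriv f e)" for e
  proof (rule Suc.IH[OF _ that])
    show "partial_deriv f e z = partial_deriv g e z" if "z \<in> W" for z
      by (rule partial_deriv_cong[OF assms(1) that Suc.prems(1)])
  qed
  moreover have "g differentiable (at z within W)" if "z \<in> W" for z
    using differentiable_transform_within[of f z W 1 g] Suc.prems that
    by (auto simp: differentiable_on_def)
  ultimately show ?case
    using Suc.prems(2) by (auto simp: differentiable_on_def)
qed

lemma Ck_on_UN_open: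
  assumes "\<And>i. i \<in> I \<Longrightarrow> open (W i)" "\<And>i. i \<in> I \<Longrightarrow> Ck_on k (W i) f"
  shows "Ck_on k (\<Union>i\<in>I. W i) f"
  using assms(2)
proof (induction k arbitrary: f)
  case 0
  then show ?case using assms(1) by (auto intro: continuous_on_open_UN)
next
  case (Suc k)
  have "f differentiable at z" if "i \<in> I" "z \<in> W i" for i z
    using Suc.prems[OF that(1)] assms(1)[OF that(1)] that
    by (simp add: differentiable_on_eq_differentiable_at)
  then have "f differentiable_on (\<Union>i\<in>I. W i)"
    by (auto simp: differentiable_on_def intro: differentiable_at_withinI)
  then show ?case using Suc by auto
qed

lemma Ck_on_add:
  assumes "open W" "Ck_on k W f" "Ck_on k W g"
  shows "Ck_on k W (\<lambda>z. f z + g z)"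
  using assms(2,3)
proof (induction k arbitrary: f g)
  case 0
  then show ?case by (auto intro: continuous_on_add)
next
  case (Suc k)
  have "f differentiable at z" "g differentiable at z" if "z \<in> W" for z
    using Suc.prems assms(1) that by (auto simp: differentiable_on_eq_differentiable_at)
  moreover have "Ck_on k W (\<lambda>z. partial_deriv f e z + partial_deriv g e z)" if "e \<in> {1, \<i>}" for e
    using that Suc by auto
  ultimately have "Ck_on k W (partial_deriv (\<lambda>z. f z + g z) e)" if "e \<in> {1, \<i>}" for e
    using that Ck_on_cong[OF assms(1), of "\<lambda>z. partial_deriv f e z + partial_deriv g e z"]
    by (simp add: partial_deriv_add)
  then show ?case using Suc.prems by auto
qed

lemma Ck_on_mult:
  assumes "open W" "Ck_on k W f" "Ck_on k W g"
  shows "Ck_on k W (\<lambda>z. f z * g z)"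
  using assms(2,3)
proof (induction k arbitrary: f g)
  case 0
  then show ?case by (auto intro: continuous_on_mult)
next
  case (Suc k)
  have d: "f differentiable at z" "g differentiable at z" if "z \<in> W" for z
    using Suc.prems assms(1) that by (auto simp: differentiable_on_eq_differentiable_at)
  have "Ck_on k W f" "Ck_on k W g"
    using Suc.prems by (blast intro: Ck_on_Suc_imp)+
  then have "Ck_on k W (\<lambda>z. f z * partial_deriv g e z + partial_deriv f e z * g z)" if "e \<in> {1, \<i>}" for e
    using that Suc by (intro Ck_on_add assms) auto
  then have "Ck_on k W (partial_deriv (\<lambda>z. f z * g z) e)" if "e \<in> {1, \<i>}" for e
    using d that Ck_on_cong[OF assms(1), of "\<lambda>z. f z * partial_deriv g e z + partial_deriv f e z * g z"]
    by (simp add: partial_deriv_mult)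
  then show ?case using Suc.prems by (auto intro: differentiable_on_mult)
qed

text \<open>For a holomorphic outer function the chain rule involves a single derivative, which is again
  holomorphic; so the induction on \<open>k\<close> runs over all \<open>F\<close> at once.\<close>

lemma Ck_on_holomorphic_compose:
  assumes "open W" "open V" "F holomorphic_on V" "h ` W \<subseteq> V" "Ck_on k W h"
  shows "Ck_on k W (\<lambda>z. F (h z))"
  using assms(3,5)
proof (induction k arbitrary: F)
  case 0
  then show ?case
    using assms(4) by (auto intro: continuous_on_compose2 holomorphic_on_imp_continuous_on)
next
  case (Suc k)
  have hd: "h differentiable at z" if "z \<in> W" for z
    using Suc.prems assms(1) that by (auto simp: differentiable_on_eq_differentiable_at)
  have "F differentiable at (h z)" if "z \<in> W" for z
    using Suc.prems(1) assms(2,4) that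
    by (auto intro!: field_differentiable_imp_differentiable holomorphic_on_imp_differentiable_at)
  then have "(\<lambda>z. F (h z)) differentiable at z" if "z \<in> W" for z
    using hd that differentiable_chain_at[of h z F] by (simp add: o_def)
  moreover have "Ck_on k W h"
    using Suc.prems by (blast intro: Ck_on_Suc_imp)
  then have "Ck_on k W (\<lambda>z. deriv F (h z) * partial_deriv h e z)" if "e \<in> {1, \<i>}" for e
    using that Suc holomorphic_deriv[OF Suc.prems(1) assms(2)] by (intro Ck_on_mult assms) auto
  then have "Ck_on k W (partial_deriv (\<lambda>z. F (h z)) e)" if "e \<in> {1, \<i>}" for e
    using that Ck_on_cong[OF assms(1), of "\<lambda>z. deriv F (h z) * partial_deriv h e z"]
      partial_deriv_holomorphic_compose[OF hd Suc.prems(1) assms(2)] assms(4)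
    by (simp add: image_subset_iff)
  ultimately show ?case
    using assms(1) by (auto simp: differentiable_on_eq_differentiable_at)
qed

lemma orient_smooth_cong:
  assumes "open W" "\<And>z. z \<in> W \<Longrightarrow> f z = g z" "orient_smooth W f"
  shows "orient_smooth W g"
proof -
  have "partial_deriv f e z = partial_deriv g e z" if "z \<in> W" for e z
    using partial_deriv_cong[OF assms(1) that] assms(2) by blast
  then show ?thesis
    using assms Ck_on_cong[OF assms(1,2)] by (auto simp: orient_smooth_def smooth_on_def wirt_def wirt_bar_def)
qed

lemma orient_smooth_subset: "orient_smooth W f \<Longrightarrow> V \<subseteq> W \<Longrightarrow> orient_smooth V f"
  by (auto simp: orient_smooth_def smooth_on_def intro: Ck_on_subset)

lemma orient_smooth_UN_open:
  assumes "\<And>i. i \<in> I \<Longrightarrow> open (W i)" "\<And>i. i \<in> I \<Longrightarrow> orient_smooth (W i) f"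
  shows "orient_smooth (\<Union>i\<in>I. W i) f"
  using assms by (auto simp: orient_smooth_def smooth_on_def intro: Ck_on_UN_open)

text \<open>Composition with \<open>F\<close> multiplies both Wirtinger derivatives by the same factor, the derivative
  of \<open>F\<close>, which is nonzero because \<open>F\<close> is injective. So the sign of the Jacobian is preserved.\<close>

lemma orient_smooth_holomorphic_compose:
  assumes "open W" "open V" "F holomorphic_on V" "inj_on F V" "h ` W \<subseteq> V" "orient_smooth W h"
  shows "orient_smooth W (\<lambda>z. F (h z))"
proof -
  have sm: "smooth_on W (\<lambda>z. F (h z))"
    using assms by (auto simp: orient_smooth_def smooth_on_def intro: Ck_on_holomorphic_compose)
  have "0 < (cmod (wirt (\<lambda>z. F (h z)) z))\<^sup>2 - (cmod (wirt_bar (\<lambda>z. F (h z)) z))\<^sup>2" if z: "z \<in> W" for z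
  proof -
    have "Ck_on (Suc 0) W h"
      using assms(6) by (simp add: orient_smooth_def smooth_on_def del: Ck_on.simps)
    then have hd: "h differentiable at z"
      using assms(1) z by (simp add: differentiable_on_eq_differentiable_at)
    have hz: "h z \<in> V" using assms(5) z by auto
    define D where "D = deriv F (h z)"
    have "D \<noteq> 0"
      unfolding D_def using holomorphic_injective_imp_regular[OF assms(3,2,4) hz] .
    have "wirt (\<lambda>z. F (h z)) z = D * wirt h z" "wirt_bar (\<lambda>z. F (h z)) z = D * wirt_bar h z"
      by (simp_all add: wirt_def wirt_bar_def D_def
          partial_deriv_holomorphic_compose[OF hd assms(3,2) hz] algebra_simps)
    then have "(cmod (wirt (\<lambda>z. F (h z)) z))\<^sup>2 - (cmod (wirt_bar (\<lambda>z. F (h z)) z))\<^sup>2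
        = (cmod D)\<^sup>2 * ((cmod (wirt h z))\<^sup>2 - (cmod (wirt_bar h z))\<^sup>2)"
      by (simp add: norm_mult power_mult_distrib algebra_simps)
    moreover have "0 < (cmod (wirt h z))\<^sup>2 - (cmod (wirt_bar h z))\<^sup>2"
      using assms(6) z by (auto simp: orient_smooth_def)
    ultimately show ?thesis
      using \<open>D \<noteq> 0\<close> by simp
  qed
  with sm show ?thesis by (simp add: orient_smooth_def)
qed

section \<open>The complex structure generated by a holomorphic atlas\<close>

lemma chart_onD:
  assumes "chart_on T euclidean (U, c)"
  shows "openin T U" "inj_on c U" "openin T V \<Longrightarrow> open (c ` (U \<inter> V))"
proof -
  show U: "openin T U" using assms by (simp add: chart_on_def)
  have hom: "homeomorphic_map (subtopology T U) (subtopology euclidean (c ` U)) c" and op: "open (c ` U)"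
    using assms by (auto simp: chart_on_def)
  have ts: "topspace (subtopology T U) = U"
    using openin_subset[OF U] by auto
  show "inj_on c U"
    using hom ts by (metis homeomorphic_map_def)
  assume "openin T V"
  then have "openin (subtopology T U) (U \<inter> V)"
    by (simp add: openin_subtopology_Int2)
  with hom have "openin (subtopology euclidean (c ` U)) (c ` (U \<inter> V))"
    using homeomorphic_imp_open_map open_map_def by blast
  with op show "open (c ` (U \<inter> V))"
    by (simp add: openin_open_eq)
qed

lemma chart_transition_factors:
  assumes "inj_on c U" "inj_on e W"
  shows "\<And>z. z \<in> c ` (U \<inter> V \<inter> W) \<Longrightarrow>
      (d \<circ> inv_into U c) z = (d \<circ> inv_into W e) ((e \<circ> inv_into U c) z)"
    and "(e \<circ> inv_into U c) ` (c ` (U \<inter> V \<inter> W)) \<subseteq> e ` (V \<inter> W)"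
  using assms by (auto simp: inv_into_f_f)

lemma image_Int_cover:
  assumes "openin T U" "(\<Union>\<kappa>\<in>A. fst \<kappa>) = topspace T"
  shows "c ` (U \<inter> V) = (\<Union>\<kappa>\<in>A. c ` (U \<inter> V \<inter> fst \<kappa>))"
proof -
  have "U \<inter> V = (\<Union>\<kappa>\<in>A. U \<inter> V \<inter> fst \<kappa>)"
    using openin_subset[OF assms(1)] unfolding assms(2)[symmetric] by blast
  then show ?thesis by (metis image_UN)
qed

definition generated_atlas :: "'a topology \<Rightarrow> ('a, complex) chart set \<Rightarrow> ('a, complex) chart set" where
  "generated_atlas T A = {\<kappa>. chart_on T euclidean \<kappa> \<and>
     (\<forall>\<kappa>'\<in>A. compatible (\<lambda>W h. h holomorphic_on W) \<kappa> \<kappa>')}"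

text \<open>Two charts that are compatible with \<open>A\<close> are compatible with each other: around each common
  point the transition map factors through a chart of \<open>A\<close>.\<close>

lemma holomorphic_transition:
  assumes A: "\<And>\<kappa>. \<kappa> \<in> A \<Longrightarrow> chart_on T euclidean \<kappa>" "(\<Union>\<kappa>\<in>A. fst \<kappa>) = topspace T"
    and c: "(U, c) \<in> generated_atlas T A" and d: "(V, d) \<in> generated_atlas T A"
  shows "(d \<circ> inv_into U c) holomorphic_on c ` (U \<inter> V)"
proof -
  have ch: "chart_on T euclidean (U, c)" "chart_on T euclidean (V, d)"
    using c d by (auto simp: generated_atlas_def)
  show ?thesis
    unfolding image_Int_cover[OF chart_onD(1)[OF ch(1)] A(2)]
  proof (rule holomorphic_on_UN_open)
    fix \<kappa> assume "\<kappa> \<in> A"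
    then obtain W e where We: "(W, e) \<in> A" and \<kappa>: "\<kappa> = (W, e)" by (cases \<kappa>) auto
    note e = chart_onD[OF A(1)[OF We]]
    have "(e \<circ> inv_into U c) holomorphic_on c ` (U \<inter> W)" "(d \<circ> inv_into W e) holomorphic_on e ` (V \<inter> W)"
      using c d We by (auto simp: generated_atlas_def compatible_def Int_commute)
    then have "((d \<circ> inv_into W e) \<circ> (e \<circ> inv_into U c)) holomorphic_on c ` (U \<inter> V \<inter> W)"
      using chart_transition_factors(2)[OF chart_onD(2)[OF ch(1)] e(2), of V]
      by (intro holomorphic_on_compose_gen[where t="e ` (V \<inter> W)"])
         (auto elim!: holomorphic_on_subset)
    then show "(d \<circ> inv_into U c) holomorphic_on c ` (U \<inter> V \<inter> fst \<kappa>)"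
      unfolding \<kappa> fst_conv
      by (rule holomorphic_transform)
         (use chart_transition_factors(1)[OF chart_onD(2)[OF ch(1)] e(2), of _ V d] in simp)
    show "open (c ` (U \<inter> V \<inter> fst \<kappa>))"
      using chart_onD(3)[OF ch(1), of "V \<inter> W"] chart_onD(1)[OF ch(2)] e(1)
      by (simp add: Int_assoc openin_Int \<kappa>)
  qed
qed

lemma generated_atlas_maximal:
  assumes "\<And>\<kappa>. \<kappa> \<in> A \<Longrightarrow> chart_on T euclidean \<kappa>" "(\<Union>\<kappa>\<in>A. fst \<kappa>) = topspace T"
    and "\<And>\<kappa> \<kappa>'. \<kappa> \<in> A \<Longrightarrow> \<kappa>' \<in> A \<Longrightarrow> compatible (\<lambda>W h. h holomorphic_on W) \<kappa> \<kappa>'"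
  shows "maximal_atlas (\<lambda>W h. h holomorphic_on W) euclidean (T, generated_atlas T A)"
proof -
  have sub: "A \<subseteq> generated_atlas T A"
    using assms(1,3) by (auto simp: generated_atlas_def)
  have "fst \<kappa> \<subseteq> topspace T" if "\<kappa> \<in> generated_atlas T A" for \<kappa>
    using that by (cases \<kappa>) (auto simp: generated_atlas_def dest: chart_onD(1) openin_subset)
  then have "(\<Union>\<kappa>\<in>generated_atlas T A. fst \<kappa>) = topspace T"
    using UN_mono[OF sub, of fst fst] assms(2) by (intro antisym UN_least) auto
  moreover have "compatible (\<lambda>W h. h holomorphic_on W) \<kappa> \<kappa>'"
    if "\<kappa> \<in> generated_atlas T A" "\<kappa>' \<in> generated_atlas T A" for \<kappa> \<kappa>'
  proof -
    obtain U c V d where "\<kappa> = (U, c)" "\<kappa>' = (V, d)" by fastforce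
    with that show ?thesis
      using holomorphic_transition[OF assms(1,2), of U c V d] holomorphic_transition[OF assms(1,2), of V d U c]
      by (simp add: compatible_def Int_commute)
  qed
  moreover have "\<kappa> \<in> generated_atlas T A"
    if "chart_on T euclidean \<kappa>"
      "\<forall>\<kappa>'\<in>generated_atlas T A. compatible (\<lambda>W h. h holomorphic_on W) \<kappa> \<kappa>'" for \<kappa>
    using that sub unfolding generated_atlas_def by blast
  moreover have "\<forall>\<kappa>\<in>generated_atlas T A. chart_on T euclidean \<kappa>"
    by (simp add: generated_atlas_def)
  ultimately show ?thesis
    unfolding maximal_atlas_def case_prod_conv by blast
qed

text \<open>If a holomorphic atlas consists of charts of the smooth surface, then each chart of the complex
  structure that it generates is locally such a smooth chart followed by a holomorphic injection.\<close>

lemma geometric_iso_id_generated_atlas: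
  assumes S: "maximal_atlas orient_smooth euclidean S" and A: "A \<subseteq> snd S" "(\<Union>\<kappa>\<in>A. fst \<kappa>) = topspace (fst S)"
  shows "geometric_iso orient_smooth S (fst S, generated_atlas (fst S) A) id"
proof -
  obtain T B where SB: "S = (T, B)" by (cases S)
  have B: "\<And>\<kappa>. \<kappa> \<in> B \<Longrightarrow> chart_on T euclidean \<kappa>"
      "\<And>\<kappa> \<kappa>'. \<kappa> \<in> B \<Longrightarrow> \<kappa>' \<in> B \<Longrightarrow> compatible orient_smooth \<kappa> \<kappa>'"
    using S by (auto simp: maximal_atlas_def SB)
  have "orient_smooth (c ` (U \<inter> V)) (d \<circ> inv_into U c)"
    if c: "(U, c) \<in> B" and d: "(V, d) \<in> generated_atlas T A" for U c V d
  proof -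
    have ch: "chart_on T euclidean (U, c)" "chart_on T euclidean (V, d)"
      using B(1)[OF c] d by (auto simp: generated_atlas_def)
    have UV: "c ` (U \<inter> V) = (\<Union>\<kappa>\<in>A. c ` (U \<inter> V \<inter> fst \<kappa>))"
      using image_Int_cover[OF chart_onD(1)[OF ch(1)], of A] A(2) SB by simp
    have op: "open (c ` (U \<inter> V \<inter> fst \<kappa>))" if "\<kappa> \<in> A" for \<kappa>
      using chart_onD(3)[OF ch(1), of "V \<inter> fst \<kappa>"] chart_onD(1)[OF ch(2)]
        chart_onD(1)[of T "fst \<kappa>" "snd \<kappa>"] B(1)[of \<kappa>] that A(1) SB
      by (auto simp: Int_assoc openin_Int)
    have "orient_smooth (c ` (U \<inter> V \<inter> W)) (d \<circ> inv_into U c)" if We: "(W, e) \<in> A" for W e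
    proof -
      have WB: "(W, e) \<in> B" using We A(1) SB by auto
      note e = chart_onD[OF B(1)[OF WB]]
      have "compatible orient_smooth (U, c) (W, e)" by (rule B(2)[OF c WB])
      then have 1: "orient_smooth (c ` (U \<inter> V \<inter> W)) (e \<circ> inv_into U c)"
        by (auto simp: compatible_def elim!: orient_smooth_subset)
      have 2: "(d \<circ> inv_into W e) holomorphic_on e ` (V \<inter> W)"
        using d We by (auto simp: generated_atlas_def compatible_def Int_commute)
      have 3: "inj_on (d \<circ> inv_into W e) (e ` (V \<inter> W))"
        using chart_onD(2)[OF ch(2)] e(2) by (auto simp: inj_on_def)
      have "open (e ` (V \<inter> W))"
        using e(3)[OF chart_onD(1)[OF ch(2)]] by (simp add: Int_commute)
      from orient_smooth_holomorphic_compose[OF op[OF We, simplified] this 2 3 _ 1]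
      have "orient_smooth (c ` (U \<inter> V \<inter> W)) (\<lambda>z. (d \<circ> inv_into W e) ((e \<circ> inv_into U c) z))"
        using chart_transition_factors(2)[OF chart_onD(2)[OF ch(1)] e(2)] by blast
      then show ?thesis
        by (rule orient_smooth_cong[OF op[OF We, simplified], rotated])
           (use chart_transition_factors(1)[OF chart_onD(2)[OF ch(1)] e(2), of _ V d] in simp)
    qed
    then show ?thesis
      unfolding UV using op by (intro orient_smooth_UN_open) auto
  qed
  then show ?thesis
    by (auto simp: geometric_iso_def SB Int_def simp flip: id_def)
qed

section \<open>The base point of Teichmueller space\<close>

lemma moeb_act_denominator_nonzero:
  fixes M :: "real^2^2"
  assumes "det M = 1" "z \<in> upper_hp"
  shows "of_real (M$2$1) * z + of_real (M$2$2) \<noteq> 0"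
proof
  assume "of_real (M$2$1) * z + of_real (M$2$2) = 0"
  then have "M$2$1 * Im z = 0" "M$2$1 * Re z + M$2$2 = 0"
    by (auto simp: complex_eq_iff)
  then have "M$2$1 = 0" "M$2$2 = 0"
    using assms(2) by (auto simp: upper_hp_def)
  then show False using assms(1) by (simp add: det_2)
qed

lemma moeb_act_holomorphic:
  fixes M :: "real^2^2"
  assumes "det M = 1"
  shows "moeb_act M holomorphic_on upper_hp"
proof -
  have "(\<lambda>z. (of_real (M$1$1) * z + of_real (M$1$2)) / (of_real (M$2$1) * z + of_real (M$2$2))) holomorphic_on upper_hp"
    using moeb_act_denominator_nonzero[OF assms] by (intro holomorphic_intros)
  then show ?thesis
    by (simp add: moeb_act_def moebius_def[abs_def])
qed

text \<open>If the transition map of two local inverses of \<open>p\<close> sends \<open>z\<close> to \<open>z'\<close>, then \<open>z' = M z\<close> for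
  some \<open>M\<close> in \<open>\<Gamma>\<close>. By continuity \<open>M\<close> maps a neighbourhood of \<open>z\<close> into the second domain, on which
  \<open>p\<close> is injective, so near \<open>z\<close> the transition map is \<open>M\<close> itself.\<close>

lemma uniformization_transition:
  assumes base: "base_uniformization S \<Gamma> p"
    and W: "open W" "W \<subseteq> upper_hp" "inj_on p W" and W': "open W'" "W' \<subseteq> upper_hp" "inj_on p W'"
  shows "(inv_into W' p \<circ> p) holomorphic_on {z \<in> W. p z \<in> p ` W'}"
  unfolding holomorphic_on_def
proof
  fix z assume "z \<in> {z \<in> W. p z \<in> p ` W'}"
  then obtain z' where z: "z \<in> W" "z' \<in> W'" "p z = p z'" by auto
  have orbit: "p x = p y \<longleftrightarrow> (\<exists>M\<in>\<Gamma>. y = moeb_act M x)" if "x \<in> upper_hp" "y \<in> upper_hp" for x y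
    using base that by (auto simp: base_uniformization_def)
  from z W(2) W'(2) orbit obtain M where M: "M \<in> \<Gamma>" "z' = moeb_act M z" by blast
  have "det M = 1"
    using base M(1) by (auto simp: base_uniformization_def fuchsian_group_def)
  note hol = moeb_act_holomorphic[OF this]
  define N where "N = W \<inter> moeb_act M -` W'"
  have "open N"
    unfolding N_def using W W'(1) hol
    by (intro continuous_open_preimage holomorphic_on_imp_continuous_on) (auto intro: holomorphic_on_subset)
  have "z \<in> N" using z M by (auto simp: N_def)
  have eq: "moeb_act M \<zeta> = (inv_into W' p \<circ> p) \<zeta>" if "\<zeta> \<in> N" for \<zeta>
  proof -
    have *: "\<zeta> \<in> upper_hp" "moeb_act M \<zeta> \<in> W'" using that W(2) by (auto simp: N_def)
    then have "p \<zeta> = p (moeb_act M \<zeta>)"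
      using orbit[of \<zeta> "moeb_act M \<zeta>"] M(1) W'(2) by blast
    with * W'(3) show ?thesis by simp
  qed
  have "moeb_act M holomorphic_on N"
    using hol W(2) by (auto simp: N_def intro: holomorphic_on_subset)
  then have "(inv_into W' p \<circ> p) holomorphic_on N"
    using eq by (rule holomorphic_transform)
  then show "(inv_into W' p \<circ> p) field_differentiable at z within {z \<in> W. p z \<in> p ` W'}"
    using \<open>open N\<close> \<open>z \<in> N\<close>
    by (auto intro: field_differentiable_at_within holomorphic_on_imp_differentiable_at)
qed

lemma teichmueller_space_nonempty:
  assumes S: "closed_oriented_surface S" and base: "base_uniformization S \<Gamma> p"
  shows "teichmueller_space S \<noteq> {}"
proof -
  define \<W> where "\<W> = {W. open W \<and> W \<subseteq> upper_hp \<and> inj_on p W \<and> (p ` W, inv_into W p) \<in> snd S}"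
  define A where "A = (\<lambda>W. (p ` W, inv_into W p)) ` \<W>"
  have max: "maximal_atlas orient_smooth euclidean S" and haus: "Hausdorff_space (fst S)"
    using S by (auto simp: closed_oriented_surface_def)
  have sub: "A \<subseteq> snd S" by (auto simp: A_def \<W>_def)
  then have charts: "chart_on (fst S) euclidean \<kappa>" if "\<kappa> \<in> A" for \<kappa>
    using that max by (cases S) (auto simp: maximal_atlas_def)
  have "\<Union>\<W> = upper_hp"
    using base unfolding base_uniformization_def \<W>_def by blast
  moreover have "(\<Union>\<kappa>\<in>A. fst \<kappa>) = p ` \<Union>\<W>"
    by (auto simp: A_def)
  ultimately have cover: "(\<Union>\<kappa>\<in>A. fst \<kappa>) = topspace (fst S)"
    using base by (simp add: base_uniformization_def)
  have transition: "(inv_into W' p \<circ> inv_into (p ` W) (inv_into W p)) holomorphic_on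
      inv_into W p ` (p ` W \<inter> p ` W')" if W: "W \<in> \<W>" and W': "W' \<in> \<W>" for W W'
  proof -
    have inj: "inj_on p W" using W by (simp add: \<W>_def)
    have "p ` W \<inter> p ` W' = p ` {z \<in> W. p z \<in> p ` W'}" by auto
    with inj have set: "inv_into W p ` (p ` W \<inter> p ` W') = {z \<in> W. p z \<in> p ` W'}"
      by (simp add: inv_into_image_cancel)
    have "inv_into (p ` W) (inv_into W p) z = p z" if "z \<in> W" for z
      using inv_into_f_f[of "inv_into W p" "p ` W" "p z"] inj that
      by (simp add: inj_on_inv_into)
    moreover have "(inv_into W' p \<circ> p) holomorphic_on {z \<in> W. p z \<in> p ` W'}"
      using W W' by (intro uniformization_transition[OF base]) (auto simp: \<W>_def)
    ultimately show ?thesis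
      unfolding set by (elim holomorphic_transform) auto
  qed
  have compat: "compatible (\<lambda>W h. h holomorphic_on W) \<kappa> \<kappa>'" if \<kappa>: "\<kappa> \<in> A" "\<kappa>' \<in> A" for \<kappa> \<kappa>'
  proof -
    obtain W W' where W: "W \<in> \<W>" "W' \<in> \<W>"
      and "\<kappa> = (p ` W, inv_into W p)" "\<kappa>' = (p ` W', inv_into W' p)"
      using \<kappa> by (auto simp: A_def)
    then show ?thesis
      using transition[OF W] transition[OF W(2,1)] by (simp add: compatible_def Int_commute)
  qed
  have "riemann_surface (fst S, generated_atlas (fst S) A)"
    using generated_atlas_maximal[OF charts cover compat] haus by (simp add: riemann_surface_def)
  moreover have "geometric_iso orient_smooth S (fst S, generated_atlas (fst S) A) id"
    by (rule geometric_iso_id_generated_atlas[OF max sub cover])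
  ultimately have "marked_riemann_surfaces S \<noteq> {}"
    by (auto simp: marked_riemann_surfaces_def)
  then show ?thesis
    by (auto simp: teichmueller_space_def quotient_def)
qed

section \<open>The moduli domain\<close>

lemma moduli_domain_line_invariant:
  assumes "z \<in> moduli_domain S \<Gamma> p \<phi>"
  shows "z + t *s axis (Inr k) 1 \<in> moduli_domain S \<Gamma> p \<phi>"
  using assms by (simp add: moduli_domain_def axis_def)

lemma moduli_domain_nonempty:
  assumes "teichmueller_space S \<noteq> {}"
  shows "moduli_domain S \<Gamma> p \<phi> \<noteq> {}"
proof -
  obtain y where y: "y \<in> teichmueller_domain S \<Gamma> p \<phi>"
    using assms by (auto simp: teichmueller_domain_def)
  have "(\<chi> k. case k of Inl i \<Rightarrow> y $ i | Inr _ \<Rightarrow> 0) \<in> moduli_domain S \<Gamma> p \<phi>"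
    using y by (simp add: moduli_domain_def)
  then show ?thesis by auto
qed

theorem theorem5p6:
  fixes S :: "('a, complex) geometry"
    and g :: nat
    and \<Gamma> :: "(real^2^2) set"
    and p\<^sub>0 :: "complex \<Rightarrow> 'a"
    and \<phi> :: "(complex \<Rightarrow> complex) \<Rightarrow> complex^'n::finite"
  assumes "closed_oriented_surface S"
    and "has_genus S g"
    and "g \<ge> 2"
    and "base_uniformization S \<Gamma> p\<^sub>0"
    and "CARD('n) = 3 * g - 3"
    and "linear_coordinates \<Gamma> \<phi>"
  shows "\<not> carries_bergman_metric (moduli_domain S \<Gamma> p\<^sub>0 \<phi>) \<and>
    (\<forall>\<Phi>. canonical_biholomorphism S \<Gamma> p\<^sub>0 \<phi> (moduli_domain S \<Gamma> p\<^sub>0 \<phi>) \<Phi> \<longrightarrow>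
         \<not> carries_bergman_metric (\<Phi> ` projective_moduli S))"
proof -
  let ?\<Omega> = "moduli_domain S \<Gamma> p\<^sub>0 \<phi>"
  have "?\<Omega> \<noteq> {}"
    using teichmueller_space_nonempty[OF assms(1,4)] by (rule moduli_domain_nonempty)
  then have "\<not> bergman_pseudometric_defined ?\<Omega>"
    by (intro line_invariant_no_bergman_pseudometric[where k="Inr undefined"] moduli_domain_line_invariant)
  then have no_metric: "\<not> carries_bergman_metric ?\<Omega>"
    by (simp add: carries_bergman_metric_def)
  moreover have "\<Phi> ` projective_moduli S = ?\<Omega>" if "canonical_biholomorphism S \<Gamma> p\<^sub>0 \<phi> ?\<Omega> \<Phi>" for \<Phi>
    using that by (simp add: canonical_biholomorphism_def bij_betw_def)
  ultimately show ?thesis by simp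
qed

end
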